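(* Let $\Gamma$ be a Carter diagram, $S=\{\tau_1,\dots,\tau_l\}\subset\varPhi$ a $\Gamma$-set, $L$ the linear span of $S$, and $\gamma\in\varPhi$ a linkage root for $S$ with orthogonal projection $\gamma_L$ onto $L$. (i) For the dual reflections $s^*_{\tau_i}$, $\tau_i\in S$, the following relations hold: $$B_\Gamma s_{\tau_i}=s^*_{\tau_i}B_\Gamma,\qquad (s_{\tau_i}\gamma)^{\nabla}=s^*_{\tau_i}B_\Gamma\gamma_L=s^*_{\tau_i}\gamma^{\nabla}.$$ (ii) For $w\in W_S$ and $w^*={}^tw^{-1}\in W_S^{\vee}$, we have $(w\gamma)^{\nabla}=w^*\gamma^{\nabla}$. (iii) The following relations hold for every $\tau_i\in S$: $$\mathscr{B}_\Gamma(s_{\tau_i}v)=\mathscr{B}_\Gamma(v)\ \text{ for any } v\in L,\qquad \mathscr{B}^{\vee}_\Gamma(s^*_{\tau_i}u^{\nabla})=\mathscr{B}^{\vee}_\Gamma(u^{\nabla})\ \text{ for any } u^{\nabla}\in L^{\nabla}.$$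
   Context: $\varPhi$ is a finite simply-laced root system with inner product $(\cdot,\cdot)$ induced by its Cartan matrix, $(\alpha,\alpha)=2$ for every root. A Carter diagram $\Gamma$ is a graph with solid and dotted edges whose nodes correspond to linearly independent roots $\tau_1,\dots,\tau_l$, with $\tau_i,\tau_j$ joined by a solid edge iff $(\tau_i,\tau_j)=-1$, by a dotted edge iff $(\tau_i,\tau_j)=1$, not joined iff $(\tau_i,\tau_j)=0$, all cycles having an even number of nodes; such a set of roots is a $\Gamma$-set. The partial Cartan matrix is $B_\Gamma=((\tau_i,\tau_j))$, positive definite. Vectors of $L$ are identified with their coordinate columns in the basis $S$, and $\langle\cdot,\cdot\rangle$ is the usual dot product of columns. $\mathscr{B}_\Gamma(v)=\langle B_\Gamma v,v\rangle$ and $\mathscr{B}^{\vee}_\Gamma(v)=\langle B_\Gamma^{-1}v,v\rangle$. For any vector $x$ of the ambient space, $x^{\nabla}=((x,\tau_1),\dots,(x,\tau_l))^t$; for $x\in L$ this equals $B_\Gamma x$. $L^{\nabla}=B_\Gamma L$ is the space spanned by the $\tau_i^{\nabla}$. A linkage root for $S$ is a root $\gamma\in\varPhi$ such that $S\cup\{\gamma\}$ is linearly independent. The reflection is $s_{\tau_i}v=v-(\tau_i,v)\tau_i$ (on $L$: $v-\langle\tau_i^{\nabla},v\rangle\tau_i$), and the dual reflection on $L^{\nabla}$ is $s^*_{\tau_i}u^{\nabla}=u^{\nabla}-\langle u^{\nabla},\tau_i\rangle\tau_i^{\nabla}$. $W_S$ is generated by the $s_{\tau_i}$ and $W_S^{\vee}$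 by the $s^*_{\tau_i}$, $\tau_i\in S$; ${}^tw^{-1}$ is the inverse transpose of the matrix of $w|_L$ in the basis $S$. *)

theory Defs
  imports "HOL-Analysis.Analysis" "HOL-Algebra.Bij" "HOL-Algebra.Generated_Groups"
begin

section \<open>Simply-laced root systems\<close>

text \<open>The reflection in a vector of squared length 2.\<close>

definition root_refl :: "'a::euclidean_space \<Rightarrow> 'a \<Rightarrow> 'a" where
  "root_refl \<alpha> x = x - (\<alpha> \<bullet> x) *\<^sub>R \<alpha>"

text \<open>All roots are normalised to squared length 2, so the Cartan integer
  \<open>2 (\<alpha>, \<beta>) / (\<alpha>, \<alpha>)\<close> is \<open>\<alpha> \<bullet> \<beta>\<close>, and the Cartan matrix is the Gram matrix of a basis of
  simple roots. The last clause contains the integrality axiom. The system need not be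
  irreducible.\<close>

definition simply_laced_root_system :: "'a::euclidean_space set \<Rightarrow> bool" where
  "simply_laced_root_system \<Phi> \<longleftrightarrow>
     finite \<Phi> \<and> span \<Phi> = UNIV \<and>
     (\<forall>\<alpha>\<in>\<Phi>. \<alpha> \<bullet> \<alpha> = 2) \<and>
     (\<forall>\<alpha>\<in>\<Phi>. \<forall>c. c *\<^sub>R \<alpha> \<in> \<Phi> \<longrightarrow> c = 1 \<or> c = - 1) \<and>
     (\<forall>\<alpha>\<in>\<Phi>. root_refl \<alpha> ` \<Phi> = \<Phi>) \<and>
     (\<forall>\<alpha>\<in>\<Phi>. \<forall>\<beta>\<in>\<Phi>. \<beta> \<noteq> \<alpha> \<and> \<beta> \<noteq> - \<alpha> \<longrightarrow> \<alpha> \<bullet> \<beta> \<in> {- 1, 0, 1})"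

section \<open>Carter diagrams\<close>

text \<open>The nodes are the elements of the finite type \<open>'n\<close>, so \<open>l = CARD('n)\<close>.\<close>

record 'n signed_graph =
  solid :: "'n \<Rightarrow> 'n \<Rightarrow> bool"
  dotted :: "'n \<Rightarrow> 'n \<Rightarrow> bool"

definition joined :: "'n signed_graph \<Rightarrow> 'n \<Rightarrow> 'n \<Rightarrow> bool" where
  "joined \<Gamma> i j \<longleftrightarrow> solid \<Gamma> i j \<or> dotted \<Gamma> i j"

definition is_signed_graph :: "'n signed_graph \<Rightarrow> bool" where
  "is_signed_graph \<Gamma> \<longleftrightarrow>
     symp (solid \<Gamma>) \<and> symp (dotted \<Gamma>) \<and> irreflp (joined \<Gamma>) \<and>
     (\<forall>i j. \<not> (solid \<Gamma> i j \<and> dotted \<Gamma> i j))"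

definition is_cycle :: "'n signed_graph \<Rightarrow> 'n list \<Rightarrow> bool" where
  "is_cycle \<Gamma> c \<longleftrightarrow>
     3 \<le> length c \<and> distinct c \<and>
     (\<forall>k<length c. joined \<Gamma> (c ! k) (c ! (Suc k mod length c)))"

text \<open>A \<open>\<Gamma>\<close>-set \<open>S = {\<tau>\<^sub>1, \<dots>, \<tau>\<^sub>l}\<close> is given as a family indexed by the nodes, so \<open>S = range \<tau>\<close>.\<close>

definition gamma_set ::
  "'a::euclidean_space set \<Rightarrow> 'n::finite signed_graph \<Rightarrow> ('n \<Rightarrow> 'a) \<Rightarrow> bool" where
  "gamma_set \<Phi> \<Gamma> \<tau> \<longleftrightarrow>
     range \<tau> \<subseteq> \<Phi> \<and> inj \<tau> \<and> independent (range \<tau>) \<and>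
     (\<forall>i j. i \<noteq> j \<longrightarrow>
        (solid \<Gamma> i j \<longleftrightarrow> \<tau> i \<bullet> \<tau> j = - 1) \<and>
        (dotted \<Gamma> i j \<longleftrightarrow> \<tau> i \<bullet> \<tau> j = 1) \<and>
        (\<not> joined \<Gamma> i j \<longleftrightarrow> \<tau> i \<bullet> \<tau> j = 0))"

definition carter_diagram ::
  "'a::euclidean_space set \<Rightarrow> 'n::finite signed_graph \<Rightarrow> bool" where
  "carter_diagram \<Phi> \<Gamma> \<longleftrightarrow>
     is_signed_graph \<Gamma> \<and> (\<forall>c. is_cycle \<Gamma> c \<longrightarrow> even (length c)) \<and>
     (\<exists>\<tau>. gamma_set \<Phi> \<Gamma> \<tau>)"

text \<open>Independence is meant for the family \<open>\<tau>\<^sub>1, \<dots>, \<tau>\<^sub>l, \<gamma>\<close>, whence \<open>\<gamma> \<notin> S\<close>: for \<open>\<gamma> \<in> S\<close> the set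
  \<open>insert \<gamma> S\<close> would be independent for trivial reasons.\<close>

definition linkage_root :: "'a::euclidean_space set \<Rightarrow> 'a set \<Rightarrow> 'a \<Rightarrow> bool" where
  "linkage_root \<Phi> S \<gamma> \<longleftrightarrow> \<gamma> \<in> \<Phi> \<and> \<gamma> \<notin> S \<and> independent (insert \<gamma> S)"

section \<open>Coordinates and the partial Cartan matrix\<close>

definition orth_proj :: "'a::euclidean_space set \<Rightarrow> 'a \<Rightarrow> 'a" where
  "orth_proj U x = (THE y. y \<in> U \<and> (\<forall>z\<in>U. orthogonal (x - y) z))"

text \<open>The coordinate column in the basis \<open>S\<close> of a vector of \<open>L\<close>; meaningful on
  \<open>L = span (range \<tau>)\<close> only.\<close>

definition coords :: "('n::finite \<Rightarrow> 'a::euclidean_space) \<Rightarrow> 'a \<Rightarrow> real ^ 'n" where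
  "coords \<tau> v = (\<chi> i. representation (range \<tau>) v (\<tau> i))"

definition cartan :: "('n::finite \<Rightarrow> 'a::euclidean_space) \<Rightarrow> real ^ 'n ^ 'n" where
  "cartan \<tau> = (\<chi> i j. \<tau> i \<bullet> \<tau> j)"

definition nabla :: "('n::finite \<Rightarrow> 'a::euclidean_space) \<Rightarrow> 'a \<Rightarrow> real ^ 'n" where
  "nabla \<tau> x = (\<chi> i. x \<bullet> \<tau> i)"

definition L_nabla :: "('n::finite \<Rightarrow> 'a::euclidean_space) \<Rightarrow> (real ^ 'n) set" where
  "L_nabla \<tau> = (\<lambda>v. cartan \<tau> *v coords \<tau> v) ` span (range \<tau>)"

definition cartan_form :: "('n::finite \<Rightarrow> 'a::euclidean_space) \<Rightarrow> 'a \<Rightarrow> real" where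
  "cartan_form \<tau> v = (cartan \<tau> *v coords \<tau> v) \<bullet> coords \<tau> v"

definition inverse_form :: "('n::finite \<Rightarrow> 'a::euclidean_space) \<Rightarrow> real ^ 'n \<Rightarrow> real" where
  "inverse_form \<tau> u = (matrix_inv (cartan \<tau>) *v u) \<bullet> u"

section \<open>Reflections, dual reflections and the groups they generate\<close>

definition dual_refl ::
  "('n::finite \<Rightarrow> 'a::euclidean_space) \<Rightarrow> 'n \<Rightarrow> real ^ 'n \<Rightarrow> real ^ 'n" where
  "dual_refl \<tau> i u = u - (u \<bullet> coords \<tau> (\<tau> i)) *\<^sub>R nabla \<tau> (\<tau> i)"

definition W_S :: "('n::finite \<Rightarrow> 'a::euclidean_space) \<Rightarrow> ('a \<Rightarrow> 'a) set" where
  "W_S \<tau> = generate (BijGroup UNIV) (range (\<lambda>i. root_refl (\<tau> i)))"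

text \<open>The dual reflections act on all columns, since \<open>L_nabla \<tau> = UNIV\<close> for independent
  \<open>\<tau>\<close> (lemma \<open>L_nabla_eq_UNIV\<close> below).\<close>

definition W_S_dual ::
  "('n::finite \<Rightarrow> 'a::euclidean_space) \<Rightarrow> (real ^ 'n \<Rightarrow> real ^ 'n) set" where
  "W_S_dual \<tau> = generate (BijGroup UNIV) (range (dual_refl \<tau>))"

text \<open>The matrix of \<open>w|\<^sub>L\<close> in the basis \<open>S\<close>; its \<open>j\<close>-th column holds the coordinates of \<open>w \<tau>\<^sub>j\<close>.\<close>

definition matrix_on_L ::
  "('n::finite \<Rightarrow> 'a::euclidean_space) \<Rightarrow> ('a \<Rightarrow> 'a) \<Rightarrow> real ^ 'n ^ 'n" where
  "matrix_on_L \<tau> w = (\<chi> i j. coords \<tau> (w (\<tau> j)) $ i)"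

definition w_star ::
  "('n::finite \<Rightarrow> 'a::euclidean_space) \<Rightarrow> ('a \<Rightarrow> 'a) \<Rightarrow> real ^ 'n \<Rightarrow> real ^ 'n" where
  "w_star \<tau> w u = transpose (matrix_inv (matrix_on_L \<tau> w)) *v u"

lemma coords_sum:
  assumes "inj \<tau>" "independent (range \<tau>)"
  shows "coords \<tau> (\<Sum>i\<in>UNIV. c $ i *\<^sub>R \<tau> i) = c"
proof -
  have "representation (range \<tau>) (\<Sum>i\<in>UNIV. c $ i *\<^sub>R \<tau> i) (\<tau> k) = c $ k" for k
  proof -
    have "representation (range \<tau>) (\<Sum>i\<in>UNIV. c $ i *\<^sub>R \<tau> i) (\<tau> k)
        = (\<Sum>i\<in>UNIV. c $ i * representation (range \<tau>) (\<tau> i) (\<tau> k))"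
      using assms(2)
      by (simp add: real_vector.representation_sum real_vector.representation_scale
          real_vector.span_base real_vector.span_scale)
    also have "\<dots> = (\<Sum>i\<in>UNIV. if i = k then c $ i else 0)"
      using assms
      by (intro sum.cong) (auto simp: real_vector.representation_basis dest: injD)
    finally show ?thesis by simp
  qed
  then show ?thesis by (simp add: coords_def vec_eq_iff)
qed

lemma cartan_mult: "cartan \<tau> *v c = nabla \<tau> (\<Sum>i\<in>UNIV. c $ i *\<^sub>R \<tau> i)"
  by (simp add: cartan_def nabla_def matrix_vector_mult_def vec_eq_iff inner_sum_left
      mult.commute) (simp add: inner_commute)

lemma L_nabla_eq_UNIV:
  assumes "inj \<tau>" "independent (range \<tau>)"
  shows "L_nabla \<tau> = UNIV"
proof -
  have zero: "c = 0" if "cartan \<tau> *v c = 0" for c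
  proof -
    define v where "v = (\<Sum>i\<in>UNIV. c $ i *\<^sub>R \<tau> i)"
    have "v \<bullet> \<tau> i = 0" for i
      using that by (simp add: cartan_mult nabla_def vec_eq_iff v_def)
    then have "v \<bullet> v = 0"
      by (subst (2) v_def) (simp add: inner_sum_right)
    then have "coords \<tau> v = 0"
      by (simp add: coords_def vec_eq_iff real_vector.representation_zero)
    then show ?thesis using coords_sum[OF assms, of c] by (simp add: v_def)
  qed
  then have "inj ((*v) (cartan \<tau>))"
    by (simp add: linear_injective_0)
  then have surj: "surj ((*v) (cartan \<tau>))"
    by (simp add: linear_injective_imp_surjective)
  have "u \<in> L_nabla \<tau>" for u
  proof -
    obtain c where c: "u = cartan \<tau> *v c" using surj by (auto elim: surjE)
    have "(\<Sum>i\<in>UNIV. c $ i *\<^sub>R \<tau> i) \<in> span (range \<tau>)"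
      by (intro span_sum span_scale span_base) simp
    then show ?thesis
      unfolding L_nabla_def using c coords_sum[OF assms, of c] by (intro image_eqI) simp_all
  qed
  then show ?thesis by auto
qed

end

theory Submission
  imports Defs
begin

text \<open>On \<open>L\<close> the matrix \<open>B\<^sub>\<Gamma>\<close> acts as \<open>\<nabla>\<close>, and \<open>\<nabla>\<close> does not see the component orthogonal to \<open>L\<close>;
  so \<open>s\<^sup>*\<close> is just \<open>s\<close> transported along \<open>\<nabla>\<close>. For an isometry \<open>w\<close> preserving \<open>L\<close>, comparing inner
  products gives \<open>\<^sup>tw (w x)\<^sup>\<nabla> = x\<^sup>\<nabla>\<close>, i.e. \<open>w\<^sup>*\<close> is \<open>w\<close> transported along \<open>\<nabla>\<close>. Both quadratic forms
  are the squared length on \<open>L\<close>, read off in two coordinate systems.\<close>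

lemma matrix_inv:
  assumes "invertible A"
  shows matrix_inv_left: "matrix_inv A ** A = mat 1"
    and matrix_inv_right: "A ** matrix_inv A = mat 1"
proof -
  have "A ** matrix_inv A = mat 1 \<and> matrix_inv A ** A = mat 1"
    using someI_ex[OF assms[unfolded invertible_def]] by (simp add: matrix_inv_def)
  then show "matrix_inv A ** A = mat 1" "A ** matrix_inv A = mat 1"
    by simp_all
qed

section \<open>Vectors of the span and their columns: coordinates, \<open>nabla\<close> and the
  partial Cartan matrix\<close>

context
  fixes \<tau> :: "'n::finite \<Rightarrow> 'a::euclidean_space"
  assumes inj_tau: "inj \<tau>" and indep_tau: "independent (range \<tau>)"
begin

lemma sum_coords:
  assumes "v \<in> span (range \<tau>)"
  shows "(\<Sum>i\<in>UNIV. coords \<tau> v $ i *\<^sub>R \<tau> i) = v"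
proof -
  have "v = (\<Sum>b\<in>range \<tau>. representation (range \<tau>) v b *\<^sub>R b)"
    using indep_tau assms by (subst real_vector.sum_representation_eq) auto
  also have "\<dots> = (\<Sum>i\<in>UNIV. coords \<tau> v $ i *\<^sub>R \<tau> i)"
    using inj_tau by (simp add: sum.reindex coords_def)
  finally show ?thesis by simp
qed

lemma cartan_coords:
  assumes "v \<in> span (range \<tau>)"
  shows "cartan \<tau> *v coords \<tau> v = nabla \<tau> v"
  by (simp add: cartan_mult sum_coords[OF assms])

text \<open>Expanding \<open>y\<close> in the basis turns the dot product of columns into the
  ambient inner product. Since \<open>x\<close> ranges over the whole space, the pairing also
  applies to roots outside the span.\<close>

lemma nabla_inner_coords:
  assumes "y \<in> span (range \<tau>)"
  shows "nabla \<tau> x \<bullet> coords \<tau> y = x \<bullet> y"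
  by (subst (2) sum_coords[OF assms, symmetric])
     (simp add: nabla_def inner_vec_def inner_sum_right mult.commute)

lemma cartan_form_eq:
  assumes "v \<in> span (range \<tau>)"
  shows "cartan_form \<tau> v = v \<bullet> v"
  by (simp add: cartan_form_def cartan_coords[OF assms] nabla_inner_coords[OF assms])

text \<open>Lets any column be replaced by \<open>nabla \<tau> v\<close> with \<open>v\<close> in
  the span, so that claims about columns reduce to claims about vectors.\<close>

lemma nabla_surj:
  obtains v where "v \<in> span (range \<tau>)" "u = nabla \<tau> v"
proof -
  have "u \<in> L_nabla \<tau>"
    by (simp add: L_nabla_eq_UNIV[OF inj_tau indep_tau])
  then obtain v where "v \<in> span (range \<tau>)" "u = cartan \<tau> *v coords \<tau> v"
    unfolding L_nabla_def by (rule imageE)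
  then show thesis
    using that by (simp add: cartan_coords)
qed

lemma invertible_cartan: "invertible (cartan \<tau>)"
proof -
  have "\<exists>c. cartan \<tau> *v c = u" for u
    by (metis nabla_surj cartan_coords)
  then have "surj ((*v) (cartan \<tau>))"
    by (auto simp: surj_def) metis
  then show ?thesis
    by (simp add: invertible_right_inverse matrix_right_invertible_surjective)
qed

text \<open>The inverse Cartan matrix takes \<open>nabla \<tau> v\<close> back to the coordinates of
  \<open>v\<close>; pairing these two columns gives the squared length.\<close>

lemma inverse_form_nabla:
  assumes "v \<in> span (range \<tau>)"
  shows "inverse_form \<tau> (nabla \<tau> v) = v \<bullet> v"
proof -
  have "matrix_inv (cartan \<tau>) *v (cartan \<tau> *v coords \<tau> v) = coords \<tau> v"
    using matrix_inv_left[OF invertible_cartan] by (simp add: matrix_vector_mul_assoc)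
  then show ?thesis
    using nabla_inner_coords[OF assms, of v]
    by (simp add: inverse_form_def cartan_coords[OF assms] inner_commute)
qed

text \<open>\<open>orth_proj\<close> is a definite description, so existence and uniqueness come
  first. The residual is then orthogonal to every \<open>\<tau> i\<close>, hence killed by
  \<open>nabla\<close>.\<close>

lemma nabla_orth_proj:
  "orth_proj (span (range \<tau>)) x \<in> span (range \<tau>)"
  "nabla \<tau> (orth_proj (span (range \<tau>)) x) = nabla \<tau> x"
proof -
  let ?L = "span (range \<tau>)"
  let ?P = "\<lambda>y. y \<in> ?L \<and> (\<forall>z\<in>?L. orthogonal (x - y) z)"
  obtain y z where y: "y \<in> ?L" and z: "\<And>w. w \<in> ?L \<Longrightarrow> orthogonal z w" and x: "x = y + z"
    using orthogonal_subspace_decomp_exists[of "range \<tau>" x] by blast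
  have "\<exists>!y. ?P y"
  proof (rule ex1I[of _ y])
    show "?P y" using y z x by simp
  next
    fix y' assume y': "?P y'"
    have d: "y' - y \<in> ?L" using y y' by (simp add: span_diff)
    \<comment> \<open>Both residuals \<open>x - y\<close> and \<open>x - y'\<close> are orthogonal
      to the span, which contains \<open>y' - y\<close>; so \<open>y' - y\<close> is orthogonal to
      itself.\<close>
    have "(y' - y) \<bullet> (y' - y) = (x - y) \<bullet> (y' - y) - (x - y') \<bullet> (y' - y)"
      by (simp add: inner_diff_left)
    also have "\<dots> = 0"
      using d y' z[OF d] x by (simp add: orthogonal_def)
    finally show "y' = y" by simp
  qed
  then have P: "?P (orth_proj ?L x)"
    unfolding orth_proj_def by (rule theI')
  then show "orth_proj ?L x \<in> ?L" by simp
  have "(x - orth_proj ?L x) \<bullet> \<tau> i = 0" for i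
    using P by (auto simp: orthogonal_def intro: span_base)
  then show "nabla \<tau> (orth_proj ?L x) = nabla \<tau> x"
    by (simp add: nabla_def vec_eq_iff inner_diff_left)
qed

text \<open>\<open>nabla\<close> is linear, and by \<open>nabla_inner_coords\<close> the coefficient
  in the dual reflection of \<open>nabla \<tau> x\<close> is \<open>x \<bullet> \<tau> i\<close>,
  the same as in the reflection of \<open>x\<close>.\<close>

lemma nabla_root_refl: "nabla \<tau> (root_refl (\<tau> i) x) = dual_refl \<tau> i (nabla \<tau> x)"
proof -
  have "(nabla \<tau> x - (x \<bullet> \<tau> i) *\<^sub>R nabla \<tau> (\<tau> i)) $ k = nabla \<tau> (root_refl (\<tau> i) x) $ k" for k
    by (simp add: nabla_def root_refl_def inner_diff_left inner_commute[of x])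
  then show ?thesis
    by (simp add: dual_refl_def nabla_inner_coords span_base vec_eq_iff)
qed

lemma w_star_nabla:
  assumes isometry: "\<And>x y. w x \<bullet> w y = x \<bullet> y"
    and in_span: "\<And>j. w (\<tau> j) \<in> span (range \<tau>)"
  shows "w_star \<tau> w (nabla \<tau> x) = nabla \<tau> (w x)"
proof -
  let ?M = "matrix_on_L \<tau> w"
  have transp: "transpose ?M *v nabla \<tau> (w x) = nabla \<tau> x" for x
  proof -
    \<comment> \<open>Column \<open>j\<close> of \<open>?M\<close> holds the coordinates of
      \<open>w (\<tau> j)\<close>, so entry \<open>j\<close> is
      \<open>w x \<bullet> w (\<tau> j)\<close>, which the isometry turns into
      \<open>x \<bullet> \<tau> j\<close>.\<close>
    have "(transpose ?M *v nabla \<tau> (w x)) $ j = nabla \<tau> (w x) \<bullet> coords \<tau> (w (\<tau> j))" for j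
      by (simp add: matrix_vector_mult_def transpose_def matrix_on_L_def inner_vec_def
          mult.commute)
    then show ?thesis
      by (simp add: vec_eq_iff nabla_inner_coords[OF in_span] isometry) (simp add: nabla_def)
  qed
  \<comment> \<open>Every column is some \<open>nabla \<tau> x\<close>, and \<open>transp\<close>
    exhibits a preimage of it; so the square matrix is invertible and \<open>matrix_inv\<close> is a
    true inverse.\<close>
  have "surj ((*v) (transpose ?M))"
    unfolding surj_def by (metis nabla_surj transp)
  then have "invertible (transpose ?M)"
    by (simp add: invertible_right_inverse matrix_right_invertible_surjective)
  then have "invertible ?M"
    using transpose_invertible[of "transpose ?M"] by simp
  then have "transpose (matrix_inv ?M) ** transpose ?M = mat 1"
    by (simp add: matrix_transpose_mul[symmetric] matrix_inv_right)
  then have "w_star \<tau> w (transpose ?M *v nabla \<tau> (w x)) = nabla \<tau> (w x)"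
    by (simp only: w_star_def matrix_vector_mul_assoc matrix_vector_mul_lid)
  then show ?thesis by (simp only: transp)
qed

end

section \<open>Reflections as isometric involutions, and the groups of bijections they
  generate\<close>

lemma root_refl_root_refl:
  assumes "\<alpha> \<bullet> \<alpha> = 2"
  shows "root_refl \<alpha> (root_refl \<alpha> x) = x"
  using assms by (simp add: root_refl_def inner_diff_right)

lemma root_refl_inner:
  assumes "\<alpha> \<bullet> \<alpha> = 2"
  shows "root_refl \<alpha> x \<bullet> root_refl \<alpha> y = x \<bullet> y"
  using assms by (simp add: root_refl_def inner_diff_right inner_diff_left inner_commute)

lemma root_refl_in_span:
  assumes "\<alpha> \<in> S" "v \<in> span S"
  shows "root_refl \<alpha> v \<in> span S"
  using assms by (simp add: root_refl_def span_diff span_scale span_base)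

text \<open>The product of \<open>BijGroup\<close> is restricted to bijections, hence the
  assumptions; over \<open>UNIV\<close>, \<open>compose\<close> is plain composition.\<close>

lemma BijGroup_UNIV_mult:
  assumes "f \<in> Bij UNIV" "g \<in> Bij UNIV"
  shows "f \<otimes>\<^bsub>BijGroup UNIV\<^esub> g = f \<circ> g"
  using assms by (auto simp: BijGroup_def compose_def fun_eq_iff)

lemma BijGroup_UNIV_one: "\<one>\<^bsub>BijGroup UNIV\<^esub> = id"
  by (simp add: BijGroup_def fun_eq_iff)

lemma involution_in_Bij_UNIV:
  assumes "\<And>x. f (f x) = x"
  shows "f \<in> Bij UNIV"
  using o_bij[of f f] assms by (simp add: Bij_def fun_eq_iff)

text \<open>Reduces the \<open>inv\<close> case of an induction over \<open>generate\<close> to the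
  case of a generator.\<close>

lemma BijGroup_UNIV_inv_involution:
  assumes "\<And>x. f (f x) = x"
  shows "inv\<^bsub>BijGroup UNIV\<^esub> f = f"
proof -
  have f: "f \<in> Bij UNIV"
    using assms by (rule involution_in_Bij_UNIV)
  have "f \<otimes>\<^bsub>BijGroup UNIV\<^esub> f = \<one>\<^bsub>BijGroup UNIV\<^esub>"
    using assms by (simp add: BijGroup_UNIV_mult[OF f f] BijGroup_UNIV_one fun_eq_iff)
  then show ?thesis
    by (rule group.inv_equality[OF group_BijGroup]) (simp_all add: BijGroup_def f)
qed

text \<open>Induction over \<open>generate\<close> yields some element of the dual group that
  transports \<open>w\<close> along \<open>nabla\<close>. As \<open>nabla\<close> is surjective,
  this element must be \<open>w_star \<tau> w\<close>, so multiplicativity of \<open>w_star\<close>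
  never has to be proved.\<close>

lemma W_S_nabla:
  fixes \<tau> :: "'n::finite \<Rightarrow> 'a::euclidean_space"
  assumes inj: "inj \<tau>" and indep: "independent (range \<tau>)" and norm: "\<And>i. \<tau> i \<bullet> \<tau> i = 2"
    and w: "w \<in> W_S \<tau>"
  shows "w_star \<tau> w \<in> W_S_dual \<tau>" "nabla \<tau> (w x) = w_star \<tau> w (nabla \<tau> x)"
proof -
  \<comment> \<open>The involution property is carried over from \<open>root_refl\<close> along
    \<open>nabla\<close>.\<close>
  have dual_invol: "dual_refl \<tau> i (dual_refl \<tau> i u) = u" for i u
  proof -
    obtain v where "u = nabla \<tau> v" by (rule nabla_surj[OF inj indep])
    then show ?thesis
      by (simp add: nabla_root_refl[OF inj indep, symmetric] root_refl_root_refl norm)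
  qed
  have gens: "range (\<lambda>i. root_refl (\<tau> i)) \<subseteq> carrier (BijGroup UNIV)"
    by (auto simp: BijGroup_def involution_in_Bij_UNIV root_refl_root_refl norm)
  have dual_gens: "range (dual_refl \<tau>) \<subseteq> carrier (BijGroup UNIV)"
    by (auto simp: BijGroup_def involution_in_Bij_UNIV dual_invol)
  have W_Bij: "f \<in> Bij UNIV" if "f \<in> generate (BijGroup UNIV) (range (\<lambda>i. root_refl (\<tau> i)))" for f
    using group.generate_in_carrier[OF group_BijGroup gens that] by (simp add: BijGroup_def)
  have dual_Bij: "f \<in> Bij UNIV" if "f \<in> W_S_dual \<tau>" for f
    using group.generate_in_carrier[OF group_BijGroup dual_gens that[unfolded W_S_dual_def]]
    by (simp add: BijGroup_def)
  have generator: "(\<forall>x y. h x \<bullet> h y = x \<bullet> y) \<and> h ` span (range \<tau>) \<subseteq> span (range \<tau>) \<and>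
      (\<exists>f\<in>W_S_dual \<tau>. \<forall>x. nabla \<tau> (h x) = f (nabla \<tau> x))"
    if "h \<in> range (\<lambda>i. root_refl (\<tau> i))" for h
  proof -
    obtain i where "h = root_refl (\<tau> i)" using \<open>h \<in> _\<close> by blast
    moreover have "dual_refl \<tau> i \<in> W_S_dual \<tau>"
      unfolding W_S_dual_def by (intro generate.incl) simp
    ultimately show ?thesis
      using nabla_root_refl[OF inj indep] by (auto simp: root_refl_inner norm root_refl_in_span)
  qed
  \<comment> \<open>The first two conjuncts supply the hypotheses of \<open>w_star_nabla\<close>;
    the third supplies the candidate for \<open>w_star \<tau> w\<close>.\<close>
  have "(\<forall>x y. w x \<bullet> w y = x \<bullet> y) \<and> w ` span (range \<tau>) \<subseteq> span (range \<tau>) \<and>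
      (\<exists>f\<in>W_S_dual \<tau>. \<forall>x. nabla \<tau> (w x) = f (nabla \<tau> x))"
    using w unfolding W_S_def
  proof (induction w rule: generate.induct)
    case one
    have "id \<in> W_S_dual \<tau>"
      using generate.one[of "BijGroup UNIV" "range (dual_refl \<tau>)"]
      by (simp add: W_S_dual_def BijGroup_UNIV_one)
    then show ?case by (auto simp: BijGroup_UNIV_one intro!: bexI[of _ id])
  next
    case (incl h)
    then show ?case by (rule generator)
  next
    case (inv h)
    then have "inv\<^bsub>BijGroup UNIV\<^esub> h = h"
      by (auto intro: BijGroup_UNIV_inv_involution simp: root_refl_root_refl norm)
    then show ?case using generator[OF inv] by simp
  next
    case (eng w1 w2)
    obtain f1 where f1: "f1 \<in> W_S_dual \<tau>" "\<forall>x. nabla \<tau> (w1 x) = f1 (nabla \<tau> x)"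
      and w1: "\<forall>x y. w1 x \<bullet> w1 y = x \<bullet> y" "w1 ` span (range \<tau>) \<subseteq> span (range \<tau>)"
      using eng.IH(1) by (elim conjE bexE)
    obtain f2 where f2: "f2 \<in> W_S_dual \<tau>" "\<forall>x. nabla \<tau> (w2 x) = f2 (nabla \<tau> x)"
      and w2: "\<forall>x y. w2 x \<bullet> w2 y = x \<bullet> y" "w2 ` span (range \<tau>) \<subseteq> span (range \<tau>)"
      using eng.IH(2) by (elim conjE bexE)
    have "f1 \<circ> f2 \<in> W_S_dual \<tau>"
      using generate.eng[of f1 "BijGroup UNIV" "range (dual_refl \<tau>)" f2] f1(1) f2(1)
      by (simp add: W_S_dual_def[symmetric] BijGroup_UNIV_mult dual_Bij)
    moreover have "\<forall>x. nabla \<tau> ((w1 \<circ> w2) x) = (f1 \<circ> f2) (nabla \<tau> x)"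
      by (simp add: f1(2) f2(2))
    ultimately have "\<exists>f\<in>W_S_dual \<tau>. \<forall>x. nabla \<tau> ((w1 \<circ> w2) x) = f (nabla \<tau> x)"
      by (rule rev_bexI[of "f1 \<circ> f2"])
    moreover have "\<forall>x y. (w1 \<circ> w2) x \<bullet> (w1 \<circ> w2) y = x \<bullet> y"
      by (simp add: w1(1) w2(1))
    moreover have "(w1 \<circ> w2) ` span (range \<tau>) \<subseteq> span (range \<tau>)"
      using w1(2) w2(2) by (auto simp: image_subset_iff)
    ultimately show ?case
      by (simp only: BijGroup_UNIV_mult[OF W_Bij[OF eng.hyps(1)] W_Bij[OF eng.hyps(2)]] simp_thms)
  qed
  then obtain f where isometry: "\<forall>x y. w x \<bullet> w y = x \<bullet> y"
    and L: "w ` span (range \<tau>) \<subseteq> span (range \<tau>)"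
    and f: "f \<in> W_S_dual \<tau>" "\<forall>x. nabla \<tau> (w x) = f (nabla \<tau> x)"
    by (elim conjE bexE)
  have in_span: "w (\<tau> j) \<in> span (range \<tau>)" for j
    using L by (simp add: image_subset_iff span_base)
  note star = w_star_nabla[OF inj indep isometry[rule_format] in_span]
  show "nabla \<tau> (w x) = w_star \<tau> w (nabla \<tau> x)"
    by (simp add: star)
  \<comment> \<open>Both maps send \<open>nabla \<tau> v\<close> to
    \<open>nabla \<tau> (w v)\<close>, and such columns exhaust the space.\<close>
  have "w_star \<tau> w u = f u" for u
  proof -
    obtain v where "u = nabla \<tau> v" by (rule nabla_surj[OF inj indep])
    then show ?thesis by (simp add: star f(2)[rule_format])
  qed
  then have "w_star \<tau> w = f" ..
  then show "w_star \<tau> w \<in> W_S_dual \<tau>" using f(1) by simp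
qed

theorem proposition3p9:
  fixes \<Phi> :: "'a::euclidean_space set"
    and \<Gamma> :: "'n::finite signed_graph"
    and \<tau> :: "'n \<Rightarrow> 'a"
    and \<gamma> :: 'a
  assumes "simply_laced_root_system \<Phi>"
    and "carter_diagram \<Phi> \<Gamma>"
    and "gamma_set \<Phi> \<Gamma> \<tau>"
    and "linkage_root \<Phi> (range \<tau>) \<gamma>"
  defines "L \<equiv> span (range \<tau>)"
  defines "\<gamma>\<^sub>L \<equiv> orth_proj L \<gamma>"
  shows
    "(\<forall>i. (\<forall>v\<in>L. cartan \<tau> *v coords \<tau> (root_refl (\<tau> i) v)
               = dual_refl \<tau> i (cartan \<tau> *v coords \<tau> v)) \<and>
          nabla \<tau> (root_refl (\<tau> i) \<gamma>) = dual_refl \<tau> i (cartan \<tau> *v coords \<tau> \<gamma>\<^sub>L) \<and>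
          dual_refl \<tau> i (cartan \<tau> *v coords \<tau> \<gamma>\<^sub>L) = dual_refl \<tau> i (nabla \<tau> \<gamma>)) \<and>
     (\<forall>w\<in>W_S \<tau>. w_star \<tau> w \<in> W_S_dual \<tau> \<and>
                nabla \<tau> (w \<gamma>) = w_star \<tau> w (nabla \<tau> \<gamma>)) \<and>
     (\<forall>i. (\<forall>v\<in>L. cartan_form \<tau> (root_refl (\<tau> i) v) = cartan_form \<tau> v) \<and>
          (\<forall>u\<in>L_nabla \<tau>. inverse_form \<tau> (dual_refl \<tau> i u) = inverse_form \<tau> u))"
proof -
  have inj: "inj \<tau>" and indep: "independent (range \<tau>)"
    using assms(3) by (simp_all add: gamma_set_def)
  have norm: "\<tau> i \<bullet> \<tau> i = 2" for i
    using assms(1,3) by (auto simp: gamma_set_def simply_laced_root_system_def)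
  note nabla_refl = nabla_root_refl[OF inj indep]
  have refl_L: "root_refl (\<tau> i) v \<in> L" if "v \<in> L" for i v
    using that unfolding L_def by (intro root_refl_in_span) simp_all
  have cartan_L: "cartan \<tau> *v coords \<tau> v = nabla \<tau> v" if "v \<in> L" for v
    using that cartan_coords[OF inj indep] by (simp add: L_def)
  have proj: "cartan \<tau> *v coords \<tau> \<gamma>\<^sub>L = nabla \<tau> \<gamma>"
    using nabla_orth_proj[OF inj indep] by (simp add: \<gamma>\<^sub>L_def L_def cartan_L[unfolded L_def])
  have i: "cartan \<tau> *v coords \<tau> (root_refl (\<tau> i) v) = dual_refl \<tau> i (cartan \<tau> *v coords \<tau> v)"
    if "v \<in> L" for i v
    using that by (simp add: cartan_L refl_L nabla_refl)
  have form: "cartan_form \<tau> (root_refl (\<tau> i) v) = cartan_form \<tau> v" if "v \<in> L" for i v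
    using cartan_form_eq[OF inj indep] refl_L[OF that] that
    by (simp add: L_def root_refl_inner norm)
  \<comment> \<open>With \<open>u = nabla \<tau> v\<close>, both sides are squared lengths, of
    \<open>root_refl (\<tau> i) v\<close> and of \<open>v\<close>.\<close>
  have inverse: "inverse_form \<tau> (dual_refl \<tau> i u) = inverse_form \<tau> u" for i u
  proof -
    obtain v where v: "v \<in> L" "u = nabla \<tau> v"
      using nabla_surj[OF inj indep] unfolding L_def by metis
    then show ?thesis
      using inverse_form_nabla[OF inj indep] refl_L[OF v(1)]
      by (simp add: L_def nabla_refl[symmetric] root_refl_inner norm)
  qed
  show ?thesis
    using i form inverse W_S_nabla[OF inj indep norm] by (simp add: proj nabla_refl)
qed

end
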